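(* Let $q\in\mathbb{N}$, let $T$ be a $(q+1)$-homogeneous tree rooted at $o$, let $\phi:T\to T$ be a self map and let $1\le p<\infty$. If $C_\phi$ is bounded on $\mathbb{T}_p$, then $$\sup_{w\in T}\ \sup_{n\in\mathbb{N}_0}\left\{\frac{W(w)}{|D_n|}N_\phi(n,w)\right\}\le\|C_\phi\|^p.$$
   Context: $\mathbb{N}=\{1,2,\ldots\}$, $\mathbb{N}_0=\mathbb{N}\cup\{0\}$. A $(q+1)$-homogeneous tree is an (infinite) connected graph without cycles in which every vertex has exactly $q+1$ neighbours; it is rooted at a fixed vertex $o$. We identify $T$ with its vertex set, and $|v|$ denotes the number of edges in the unique path from $o$ to $v$. A self map of $T$ is an arbitrary function $\phi:T\to T$ on vertices. For $f:T\to\mathbb{C}$ put $M_p(0,f)=|f(o)|$ and, for $n\in\mathbb{N}$, $M_p(n,f)=\left(\frac{1}{(q+1)q^{n-1}}\sum_{|v|=n}|f(v)|^p\right)^{1/p}$. Let $\|f\|_p=\sup_{n\in\mathbb{N}_0}M_p(n,f)$ and $\mathbb{T}_p=\{f:T\to\mathbb{C} : \|f\|_p<\infty\}$. The composition operator is $C_\phi f=f\circ\phi$. Its operator norm is $\|C_\phi\|=\sup\{\|f\circ\phi\|_p : \|f\|_p=1\}$, and $C_\phi$ is bounded on $\mathbb{T}_p$ if it maps $\mathbb{T}_p$ into itself and $\|C_\phi\|<\infty$. For $n\in\mathbb{N}_0$ and $w\in T$, $N_\phi(n,w)$ is the number of vertices $v$ with $|v|=n$ and $\phi(v)=w$. The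 weight function is $W(w)=(q+1)q^{|w|-1}$ if $w\ne o$ and $W(o)=1$. $|D_n|$ is the number of vertices $v$ with $|v|=n$, i.e. $|D_n|=(q+1)q^{n-1}$ for $n\in\mathbb{N}$ and $|D_0|=1$. *)

theory Defs
  imports Complex_Main "HOL-Library.Extended_Nonnegative_Real"
begin

text \<open>A graph is an adjacency relation on a vertex type, so that complex functions on the
  vertices and self maps are plain functions. Paths and cycles are lists of vertices.\<close>

definition simple_graph :: "('v \<Rightarrow> 'v \<Rightarrow> bool) \<Rightarrow> bool" where
  "simple_graph E \<longleftrightarrow> symp E \<and> irreflp E"

definition path_between :: "('v \<Rightarrow> 'v \<Rightarrow> bool) \<Rightarrow> 'v \<Rightarrow> 'v list \<Rightarrow> 'v \<Rightarrow> bool" where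
  "path_between E u xs v \<longleftrightarrow>
     xs \<noteq> [] \<and> hd xs = u \<and> last xs = v \<and> distinct xs \<and> successively E xs"

definition graph_cycle :: "('v \<Rightarrow> 'v \<Rightarrow> bool) \<Rightarrow> 'v list \<Rightarrow> bool" where
  "graph_cycle E xs \<longleftrightarrow>
     length xs \<ge> 3 \<and> distinct xs \<and> successively E xs \<and> E (last xs) (hd xs)"

text \<open>Such a tree is automatically infinite when \<open>q \<ge> 1\<close>. Since \<open>card\<close> of an infinite set is 0,
  the cardinality condition includes local finiteness.\<close>

definition homogeneous_tree :: "nat \<Rightarrow> ('v \<Rightarrow> 'v \<Rightarrow> bool) \<Rightarrow> bool" where
  "homogeneous_tree q E \<longleftrightarrow>
     simple_graph E \<and>
     (\<forall>u v. \<exists>xs. path_between E u xs v) \<and>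
     (\<nexists>xs. graph_cycle E xs) \<and>
     (\<forall>v. card {u. E v u} = q + 1)"

text \<open>The number of edges of a path is one less than its number of vertices.\<close>

definition level :: "('v \<Rightarrow> 'v \<Rightarrow> bool) \<Rightarrow> 'v \<Rightarrow> 'v \<Rightarrow> nat" where
  "level E r v = length (THE xs. path_between E r xs v) - 1"

definition sphere_card :: "('v \<Rightarrow> 'v \<Rightarrow> bool) \<Rightarrow> 'v \<Rightarrow> nat \<Rightarrow> nat" where
  "sphere_card E r n = card {v. level E r v = n}"

definition M_mean ::
    "nat \<Rightarrow> ('v \<Rightarrow> 'v \<Rightarrow> bool) \<Rightarrow> 'v \<Rightarrow> real \<Rightarrow> nat \<Rightarrow> ('v \<Rightarrow> complex) \<Rightarrow> real" where
  "M_mean q E r p n f =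
     (if n = 0 then norm (f r)
      else (1 / (real (q + 1) * real q ^ (n - 1)) *
              (\<Sum>v | level E r v = n. norm (f v) powr p)) powr (1 / p))"

definition T_norm ::
    "nat \<Rightarrow> ('v \<Rightarrow> 'v \<Rightarrow> bool) \<Rightarrow> 'v \<Rightarrow> real \<Rightarrow> ('v \<Rightarrow> complex) \<Rightarrow> ennreal" where
  "T_norm q E r p f = (SUP n. ennreal (M_mean q E r p n f))"

definition T_space ::
    "nat \<Rightarrow> ('v \<Rightarrow> 'v \<Rightarrow> bool) \<Rightarrow> 'v \<Rightarrow> real \<Rightarrow> ('v \<Rightarrow> complex) set" where
  "T_space q E r p = {f. T_norm q E r p f < \<infinity>}"

definition comp_op :: "('v \<Rightarrow> 'v) \<Rightarrow> ('v \<Rightarrow> complex) \<Rightarrow> ('v \<Rightarrow> complex)" where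
  "comp_op \<phi> f = f \<circ> \<phi>"

definition comp_op_norm ::
    "nat \<Rightarrow> ('v \<Rightarrow> 'v \<Rightarrow> bool) \<Rightarrow> 'v \<Rightarrow> real \<Rightarrow> ('v \<Rightarrow> 'v) \<Rightarrow> ennreal" where
  "comp_op_norm q E r p \<phi> =
     (SUP f \<in> {f. T_norm q E r p f = 1}. T_norm q E r p (comp_op \<phi> f))"

definition comp_op_bounded ::
    "nat \<Rightarrow> ('v \<Rightarrow> 'v \<Rightarrow> bool) \<Rightarrow> 'v \<Rightarrow> real \<Rightarrow> ('v \<Rightarrow> 'v) \<Rightarrow> bool" where
  "comp_op_bounded q E r p \<phi> \<longleftrightarrow>
     (\<forall>f \<in> T_space q E r p. comp_op \<phi> f \<in> T_space q E r p) \<and>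
     comp_op_norm q E r p \<phi> < \<infinity>"

definition preimage_count ::
    "('v \<Rightarrow> 'v \<Rightarrow> bool) \<Rightarrow> 'v \<Rightarrow> ('v \<Rightarrow> 'v) \<Rightarrow> nat \<Rightarrow> 'v \<Rightarrow> nat" where
  "preimage_count E r \<phi> n w = card {v. level E r v = n \<and> \<phi> v = w}"

definition vertex_weight :: "nat \<Rightarrow> ('v \<Rightarrow> 'v \<Rightarrow> bool) \<Rightarrow> 'v \<Rightarrow> 'v \<Rightarrow> real" where
  "vertex_weight q E r w =
     (if w = r then 1 else real (q + 1) * real q ^ (level E r w - 1))"

end

theory Submission imports Defs begin

text \<open>Test the norm on \<open>f = W(w)\<^sup>1\<^sup>/\<^sup>p \<cdot> 1\<^sub>w\<close>. Since the sphere of radius \<open>n \<ge> 1\<close> has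
  exactly \<open>(q + 1) q\<^sup>n\<^sup>-\<^sup>1\<close> vertices, \<open>f\<close> has norm 1, while the \<open>p\<close>-th power of the \<open>n\<close>-th mean of
  \<open>f \<circ> \<phi>\<close> is \<open>W(w) N(n, w) / |D\<^sub>n|\<close>. The size of the sphere comes from counting the simple
  paths issuing from the root, which acyclicity puts in bijection with their endpoints.\<close>

section \<open>Uniqueness of simple paths in an acyclic graph\<close>

text \<open>Induction strips the common first vertex. If the second vertices differed, the two
  tails, which both end in \<open>v\<close>, would meet again and close a cycle through
  \<open>u\<close>.\<close>

lemma path_between_unique:
  assumes sym: "symp E" and acyc: "\<nexists>zs. graph_cycle E zs"
    and "path_between E u xs v" "path_between E u ys v"
  shows "xs = ys"
  using assms(3,4)
proof (induction xs arbitrary: u ys)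
  case Nil
  then show ?case by (simp add: path_between_def)
next
  case (Cons x xs)
  then have x: "x = u" by (simp add: path_between_def)
  from Cons.prems obtain ys' where ys: "ys = u # ys'"
    by (cases ys) (auto simp: path_between_def)
  show ?case
  proof (cases "u = v")
    \<comment> \<open>A distinct list whose head is also its last entry has only one vertex.\<close>
    case True
    with Cons.prems x ys show ?thesis
      by (auto simp: path_between_def split: if_splits)
  next
    case False
    with Cons.prems x ys have ne: "xs \<noteq> []" "ys' \<noteq> []" "last xs = v" "last ys' = v"
      and d: "distinct xs" "distinct ys'" "u \<notin> set xs" "u \<notin> set ys'"
      and s: "successively E xs" "successively E ys'" "E u (hd xs)" "E u (hd ys')"
      by (auto simp: path_between_def successively_Cons split: if_split_asm)
    have "hd xs = hd ys'"
    proof (rule ccontr)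
      assume neq: "hd xs \<noteq> hd ys'"
      have "\<exists>c\<in>set xs. c \<in> set ys'"
        using ne by (metis last_in_set)
      \<comment> \<open>Taking the first \<open>c\<close> of \<open>xs\<close> that lies on
        \<open>ys'\<close> keeps \<open>P\<close> disjoint from \<open>ys'\<close>; the cycle
        follows \<open>P\<close> to \<open>c\<close> and returns to \<open>u\<close> along the
        reversed \<open>Q\<close>.\<close>
      then obtain P c P' where P: "xs = P @ c # P'" "c \<in> set ys'" "\<forall>y\<in>set P. y \<notin> set ys'"
        by (rule split_list_first_propE)
      then obtain Q Q' where Q: "ys' = Q @ c # Q'" "c \<notin> set Q"
        by (blast dest: split_list_first)
      \<comment> \<open>A cycle needs a third vertex besides \<open>u\<close> and \<open>c\<close>:
        with \<open>P\<close> and \<open>Q\<close> both empty, both tails would start at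
        \<open>c\<close>.\<close>
      have PQ: "P \<noteq> [] \<or> Q \<noteq> []"
        using neq P Q by auto
      have "successively E (rev (Q @ [c]))"
        unfolding successively_rev using s(2) Q sympD[OF sym]
        by (auto simp: successively_append_iff elim!: successively_mono)
      moreover have "successively E (P @ [c])"
        using s(1) P by (auto simp: successively_append_iff)
      ultimately have "successively E (u # P @ c # rev Q)"
        using s(3) P by (auto simp: successively_append_iff successively_Cons hd_append)
      moreover have "E (last (u # P @ c # rev Q)) u"
        using s(4) Q sympD[OF sym] by (cases Q) (auto simp: last_rev)
      moreover have "distinct (u # P @ c # rev Q)"
        using d P Q by auto
      moreover have "length (u # P @ c # rev Q) \<ge> 3"
        using PQ by (cases P; cases Q) auto
      ultimately have "graph_cycle E (u # P @ c # rev Q)"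
        unfolding graph_cycle_def by simp
      with acyc show False by blast
    qed
    then have "path_between E (hd xs) xs v" "path_between E (hd xs) ys' v"
      using ne d s by (auto simp: path_between_def)
    from Cons.IH[OF this] x ys show ?thesis by simp
  qed
qed

section \<open>Counting simple paths from the root\<close>

text \<open>Using \<open>last xs\<close> as the endpoint leaves it free; \<open>Suc n\<close>
  vertices make \<open>n\<close> edges.\<close>

definition simple_paths :: "('v \<Rightarrow> 'v \<Rightarrow> bool) \<Rightarrow> 'v \<Rightarrow> nat \<Rightarrow> 'v list set" where
  "simple_paths E r n = {xs. path_between E r xs (last xs) \<and> length xs = Suc n}"

lemma simple_paths_0: "simple_paths E r 0 = {[r]}"
  by (auto simp: simple_paths_def path_between_def length_Suc_conv)

lemma simple_paths_Suc:
  "simple_paths E r (Suc n) =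
     (\<Union>xs\<in>simple_paths E r n. (\<lambda>w. xs @ [w]) ` {w. E (last xs) w \<and> w \<notin> set xs})"
  (is "?L = ?R")
proof
  show "?L \<subseteq> ?R"
  proof
    fix ys assume ys: "ys \<in> ?L"
    then obtain xs w where "ys = xs @ [w]"
      by (cases ys rule: rev_cases) (auto simp: simple_paths_def)
    moreover from this ys have "xs \<noteq> []"
      by (auto simp: simple_paths_def)
    ultimately show "ys \<in> ?R"
      using ys by (auto simp: simple_paths_def path_between_def successively_append_iff)
  qed
  show "?R \<subseteq> ?L"
    by (auto simp: simple_paths_def path_between_def successively_append_iff)
qed

text \<open>An edge from \<open>v\<close> back to a vertex before \<open>u\<close> would close a
  cycle. Hence the predecessor is the only neighbour lost when a path is extended.\<close>

lemma neighbours_on_path: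
  assumes sym: "symp E" and irr: "irreflp E" and acyc: "\<nexists>zs. graph_cycle E zs"
    and xs: "xs @ [u, v] \<in> simple_paths E r n"
  shows "{w. E v w} \<inter> set (xs @ [u, v]) = {u}"
proof -
  have d: "distinct (xs @ [u, v])" and s: "successively E (xs @ [u, v])"
    using xs by (auto simp: simple_paths_def path_between_def)
  have "E v u"
    using s sympD[OF sym] by (auto simp: successively_append_iff)
  moreover have "\<not> E v v"
    using irr by (simp add: irreflp_def)
  moreover have "\<not> E v w" if "w \<in> set xs" for w
  proof
    assume "E v w"
    from that obtain A B where AB: "xs = A @ w # B"
      using split_list by metis
    \<comment> \<open>The segment from \<open>w\<close> to \<open>v\<close> passes through
      \<open>u\<close>, so it has at least three vertices.\<close>
    have "graph_cycle E (w # B @ [u, v])"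
      using d s AB \<open>E v w\<close> by (auto simp: graph_cycle_def successively_append_iff)
    with acyc show False by blast
  qed
  ultimately show ?thesis by auto
qed

lemma card_simple_paths:
  assumes tree: "homogeneous_tree q E"
  shows "finite (simple_paths E r n) \<and>
    card (simple_paths E r n) = (if n = 0 then 1 else (q + 1) * q ^ (n - 1))"
proof (induction n)
  case 0
  show ?case by (simp add: simple_paths_0)
next
  case (Suc n)
  have sym: "symp E" and irr: "irreflp E" and acyc: "\<nexists>zs. graph_cycle E zs"
    and deg: "\<And>v. card {u. E v u} = q + 1"
    using tree by (auto simp: homogeneous_tree_def simple_graph_def)
  \<comment> \<open>An infinite neighbourhood would have \<open>card\<close> equal to 0.\<close>
  have fin: "finite {u. E v u}" for v
    using deg[of v] by (metis card.infinite add_is_0 one_neq_zero)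
  let ?C = "\<lambda>xs. {w. E (last xs) w \<and> w \<notin> set xs}"
  have finC: "finite (?C xs)" for xs
    by (rule finite_subset[OF _ fin[of "last xs"]]) auto
  \<comment> \<open>The root has no predecessor, so the first step has one more choice than every
    later one.\<close>
  have cardC: "card (?C xs) = (if n = 0 then q + 1 else q)" if xs: "xs \<in> simple_paths E r n" for xs
  proof (cases "n = 0")
    case True
    with xs have "xs = [r]" by (simp add: simple_paths_0)
    then have "?C xs = {u. E r u}"
      using irr by (auto simp: irreflp_def)
    with deg True show ?thesis by simp
  next
    case False
    then obtain as v where 1: "xs = as @ [v]" "as \<noteq> []"
      using xs by (cases xs rule: rev_cases) (auto simp: simple_paths_def)
    then obtain bs u where "as = bs @ [u]"
      by (cases as rule: rev_cases) auto
    with 1 have eq: "xs = bs @ [u, v]" by simp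
    have on_path: "{w. E v w} \<inter> set xs = {u}"
      using neighbours_on_path[OF sym irr acyc] xs unfolding eq by blast
    then have "?C xs = {w. E v w} - {u}"
      unfolding eq by auto
    moreover have "E v u" using on_path by auto
    ultimately show ?thesis using deg[of v] fin[of v] False by simp
  qed
  \<comment> \<open>The sets of extensions are disjoint because \<open>xs @ [w]\<close> determines
    \<open>xs\<close>.\<close>
  have "card (simple_paths E r (Suc n)) =
      (\<Sum>xs\<in>simple_paths E r n. card ((\<lambda>w. xs @ [w]) ` ?C xs))"
    unfolding simple_paths_Suc using Suc finC by (intro card_UN_disjoint) auto
  also have "\<dots> = (\<Sum>xs\<in>simple_paths E r n. card (?C xs))"
    by (intro sum.cong card_image refl) (auto intro: inj_onI)
  also have "\<dots> = card (simple_paths E r n) * (if n = 0 then q + 1 else q)"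
    using cardC by simp
  also have "\<dots> = (q + 1) * q ^ n"
    using Suc by (cases n) (auto simp: algebra_simps)
  finally show ?case
    using Suc finC by (auto simp: simple_paths_Suc)
qed

section \<open>Levels and sizes of spheres\<close>

lemma level_eq:
  assumes tree: "homogeneous_tree q E" and "path_between E r xs v"
  shows "level E r v = length xs - 1"
proof -
  have "(THE xs. path_between E r xs v) = xs"
    using assms path_between_unique[of E r _ v]
    by (intro the_equality) (auto simp: homogeneous_tree_def simple_graph_def)
  then show ?thesis by (simp add: level_def)
qed

text \<open>Injectivity is uniqueness of paths, surjectivity is connectedness.\<close>

lemma sphere_bij:
  assumes tree: "homogeneous_tree q E"
  shows "bij_betw last (simple_paths E r n) {v. level E r v = n}"
proof (rule bij_betwI')
  fix xs ys assume "xs \<in> simple_paths E r n" "ys \<in> simple_paths E r n"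
  then show "last xs = last ys \<longleftrightarrow> xs = ys"
    using tree path_between_unique[of E r xs "last xs" ys]
    by (auto simp: simple_paths_def homogeneous_tree_def simple_graph_def)
next
  fix xs assume "xs \<in> simple_paths E r n"
  then show "last xs \<in> {v. level E r v = n}"
    using level_eq[OF tree] by (auto simp: simple_paths_def)
next
  fix v assume v: "v \<in> {v. level E r v = n}"
  obtain xs where xs: "path_between E r xs v"
    using tree unfolding homogeneous_tree_def by blast
  \<comment> \<open>Positivity lets the truncated \<open>length xs - 1 = n\<close> be turned into
    \<open>length xs = Suc n\<close>.\<close>
  then have "length xs > 0" by (simp add: path_between_def)
  with xs level_eq[OF tree xs] v show "\<exists>xs\<in>simple_paths E r n. v = last xs"
    by (intro bexI[of _ xs]) (auto simp: simple_paths_def path_between_def simp del: length_greater_0_conv)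
qed

lemma finite_sphere:
  assumes "homogeneous_tree q E"
  shows "finite {v. level E r v = n}"
  using bij_betw_finite[OF sphere_bij[OF assms]] card_simple_paths[OF assms] by blast

lemma sphere_card_eq:
  assumes "homogeneous_tree q E"
  shows "sphere_card E r n = (if n = 0 then 1 else (q + 1) * q ^ (n - 1))"
  using bij_betw_same_card[OF sphere_bij[OF assms]] card_simple_paths[OF assms]
  by (metis sphere_card_def)

lemma level_eq_0_iff:
  assumes "homogeneous_tree q E"
  shows "level E r v = 0 \<longleftrightarrow> v = r"
  using bij_betw_imp_surj_on[OF sphere_bij[OF assms, of r 0]] by (auto simp: simple_paths_0)

section \<open>Means of the test functions\<close>

text \<open>Absorbs the separate case \<open>n = 0\<close>: that sphere is \<open>{r}\<close>, and
  the powers \<open>p\<close> and \<open>1 / p\<close> cancel.\<close>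

lemma M_mean_eq:
  assumes tree: "homogeneous_tree q E" and p: "1 \<le> p"
  shows "M_mean q E r p n f =
    ((\<Sum>v | level E r v = n. norm (f v) powr p) / real (sphere_card E r n)) powr (1 / p)"
proof (cases "n = 0")
  case True
  with p show ?thesis
    by (simp add: M_mean_def sphere_card_eq[OF tree] level_eq_0_iff[OF tree] powr_powr)
next
  case False
  then show ?thesis
    by (simp add: M_mean_def sphere_card_eq[OF tree] algebra_simps)
qed

lemma vertex_weight_eq:
  assumes "homogeneous_tree q E"
  shows "vertex_weight q E r w = real (sphere_card E r (level E r w))"
  by (simp add: vertex_weight_def sphere_card_eq[OF assms] level_eq_0_iff[OF assms] algebra_simps)

text \<open>The height is chosen so that its \<open>p\<close>-th power is the size of the sphere
  through \<open>w\<close>.\<close>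

definition point_mass ::
    "nat \<Rightarrow> ('v \<Rightarrow> 'v \<Rightarrow> bool) \<Rightarrow> 'v \<Rightarrow> real \<Rightarrow> 'v \<Rightarrow> 'v \<Rightarrow> complex" where
  "point_mass q E r p w v =
     (if v = w then of_real (vertex_weight q E r w powr (1 / p)) else 0)"

text \<open>Serves twice: the identity as \<open>\<phi>\<close> gives the means of the point mass
  itself.\<close>

lemma M_mean_point_mass_comp:
  assumes tree: "homogeneous_tree q E" and p: "1 \<le> p"
  shows "M_mean q E r p n (point_mass q E r p w \<circ> \<phi>) =
    (vertex_weight q E r w / real (sphere_card E r n) * real (preimage_count E r \<phi> n w))
      powr (1 / p)"
proof -
  have W: "0 \<le> vertex_weight q E r w"
    by (simp add: vertex_weight_def)
  have "(\<Sum>v | level E r v = n. norm (point_mass q E r p w (\<phi> v)) powr p) =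
      (\<Sum>v | level E r v = n. if \<phi> v = w then vertex_weight q E r w else 0)"
    using W p by (intro sum.cong refl) (auto simp: point_mass_def powr_powr)
  also have "\<dots> = real (preimage_count E r \<phi> n w) * vertex_weight q E r w"
    using finite_sphere[OF tree, of r n]
    by (simp add: sum.If_cases preimage_count_def Int_def)
  finally show ?thesis
    by (simp add: M_mean_eq[OF tree p] mult.commute)
qed

lemma T_norm_point_mass:
  assumes q: "q \<ge> 1" and tree: "homogeneous_tree q E" and p: "1 \<le> p"
  shows "T_norm q E r p (point_mass q E r p w) = 1"
proof -
  have pos: "sphere_card E r n > 0" for n
    using q by (simp add: sphere_card_eq[OF tree])
  \<comment> \<open>With the identity map the preimage count is 1 on the sphere through
    \<open>w\<close> and 0 on all others.\<close>
  have "{v. level E r v = n \<and> v = w} = (if n = level E r w then {w} else {})" for n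
    by auto
  then have M: "M_mean q E r p n (point_mass q E r p w) = (if n = level E r w then 1 else 0)" for n
    using M_mean_point_mass_comp[OF tree p, of r n w "\<lambda>v. v"] pos
    by (simp add: comp_def preimage_count_def vertex_weight_eq[OF tree] split: if_splits)
  show ?thesis
    unfolding T_norm_def M
    by (rule antisym[OF SUP_least]) (auto intro: SUP_upper2[of "level E r w"])
qed

theorem theorem4:
  fixes q :: nat
    and E :: "'v \<Rightarrow> 'v \<Rightarrow> bool"
    and r :: 'v
    and \<phi> :: "'v \<Rightarrow> 'v"
    and p :: real
  assumes "q \<ge> 1"
    and "homogeneous_tree q E"
    and "1 \<le> p"
    and "comp_op_bounded q E r p \<phi>"
  shows "(SUP w. SUP n. ennreal (vertex_weight q E r w / real (sphere_card E r n)
                                   * real (preimage_count E r \<phi> n w)))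
           \<le> ennreal (enn2real (comp_op_norm q E r p \<phi>) powr p)"
proof (intro SUP_least)
  fix w n
  let ?x = "vertex_weight q E r w / real (sphere_card E r n) * real (preimage_count E r \<phi> n w)"
  let ?K = "comp_op_norm q E r p \<phi>"
  have x: "0 \<le> ?x" by (simp add: vertex_weight_def)
  have "ennreal (?x powr (1 / p)) \<le> T_norm q E r p (comp_op \<phi> (point_mass q E r p w))"
    unfolding T_norm_def comp_op_def M_mean_point_mass_comp[OF assms(2,3), symmetric]
    by (rule SUP_upper) simp
  also have "\<dots> \<le> ?K"
    unfolding comp_op_norm_def
    by (rule SUP_upper) (simp add: T_norm_point_mass[OF assms(1-3)])
  \<comment> \<open>Boundedness makes \<open>?K\<close> finite; \<open>enn2real\<close> would send
    an infinite value to 0.\<close>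
  also have "?K = ennreal (enn2real ?K)"
    using assms(4) by (simp add: comp_op_bounded_def)
  finally have "?x powr (1 / p) \<le> enn2real ?K"
    by (simp add: ennreal_le_iff)
  then have "(?x powr (1 / p)) powr p \<le> enn2real ?K powr p"
    using assms(3) by (intro powr_mono2) auto
  \<comment> \<open>The exponents multiply to 1, and \<open>?x powr 1 = ?x\<close> because
    \<open>?x\<close> is nonnegative.\<close>
  moreover have "(?x powr (1 / p)) powr p = ?x"
    using powr_powr[of ?x "1 / p" p] powr_one[OF x] assms(3) by (metis eq_divide_eq not_one_le_zero)
  ultimately have "?x \<le> enn2real ?K powr p"
    by simp
  then show "ennreal ?x \<le> ennreal (enn2real ?K powr p)"
    by (rule ennreal_leI)
qed

end
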